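(* Let $d>1$ and let $\psi:\mathbb{R}\to\mathbb{R}$ be a $C^\infty$ function such that $f\circ\psi\in\Sigma_d(\mathbb{R})$ for every $f\in\Sigma_d(\mathbb{R})$. Then $\psi'$ is bounded on $\mathbb{R}$.
   Context: For $d>1$, the Gelfand-Shilov space $\Sigma_d(\mathbb{R})$ (of Beurling type) consists of all (complex-valued) $f\in C^\infty(\mathbb{R})$ such that for every $h>0$, $\displaystyle\sup_{x\in\mathbb{R}}\sup_{j,\ell\in\mathbb{N}_0}\frac{|x^\ell f^{(j)}(x)|}{h^{j+\ell}\,((j+\ell)!)^d}<\infty$. *)

theory Defs
  imports "HOL-Analysis.Analysis"
begin

definition iter_deriv :: "nat \<Rightarrow> (real \<Rightarrow> 'a::real_normed_vector) \<Rightarrow> real \<Rightarrow> 'a" where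
  "iter_deriv j f = ((\<lambda>g x. vector_derivative g (at x)) ^^ j) f"

(* Since vector_derivative is total, the existence of every derivative is required explicitly;
   continuity of each derivative follows from differentiability. *)
definition smooth :: "(real \<Rightarrow> 'a::real_normed_vector) \<Rightarrow> bool" where
  "smooth f \<longleftrightarrow> (\<forall>j x. iter_deriv j f differentiable at x)"

(* The Beurling-type Gelfand-Shilov space \<open>\<Sigma>\<^sub>d(\<real>)\<close>. Boundedness above of the quotients, jointly in
   \<open>(x, j, l)\<close>, is finiteness of the iterated supremum. *)
definition gelfand_shilov :: "real \<Rightarrow> (real \<Rightarrow> complex) set" where
  "gelfand_shilov d = {f. smooth f \<and>
     (\<forall>h>0. bdd_above (range (\<lambda>(x, j, l).
        norm (x ^ l *\<^sub>R iter_deriv j f x) / (h ^ (j + l) * fact (j + l) powr d))))}"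

end

(* The functionals f |-> (f o psi)^(j)(x) / j!^d are continuous on the Gelfand-Shilov space and
   pointwise bounded, so by uniform boundedness they are all bounded by C p_h for one h > 0, where p_h
   is the seminorm with parameter h. Test this on
     f(y) = e^(-dj) sin(k j^(d-1) (y - psi x))^j e^(-y^2),   k = h/2.
   The seminorms p_h(f) stay bounded in j, since the sine factor has frequency at most k j^d and
   e^(-dj) j^(di) <= i!^d. All derivatives of f of order below j vanish at psi x, so only the top term of
   the chain rule survives and |(f o psi)^(j)(x)| >= (k e^(-d) |psi'(x)|)^j j!^d e^(-(psi x)^2).
   Letting j tend to infinity gives |psi'(x)| <= 2 e^d / h. *)
theory Submission
  imports Defs
begin

text \<open>The chain rule of order j involves every derivative of \<psi> up to order j, and none of
  them is under control. A test function with a zero of exact order j at \<open>\<psi> x\<close>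
  hides all of them except a power of the first. Such a function depends on j and x, whereas the
  hypothesis speaks of one f at a time; uniform boundedness turns it into an estimate with constants
  chosen before f. The h that it yields cannot be prescribed, so the test functions are built for
  arbitrary h.

  The exponents are a balance. A zero of order j with frequency \<xi> has j-th derivative
  \<open>fact j * \<xi> ^ j\<close>; to reach \<open>fact j powr d\<close> up to a geometric factor,
  \<xi> is given the size \<open>j powr (d - 1)\<close>. The price is a total frequency
  \<open>j * \<xi>\<close> of size \<open>j powr d\<close>, paid for by the amplitude
  \<open>exp (- d * j)\<close>, again a geometric factor. The Gaussian supplies decay. Its value at
  \<open>\<psi> x\<close> may be tiny but does not depend on j, so at fixed x it is harmless as j
  grows, and the final bound is free of x.\<close>

section \<open>Calculus of iterated derivatives\<close>

lemma iter_deriv_0 [simp]: "iter_deriv 0 f = f"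
  by (simp add: iter_deriv_def)

lemma iter_deriv_Suc: "iter_deriv (Suc n) f x = vector_derivative (iter_deriv n f) (at x)"
  by (simp add: iter_deriv_def)

lemma smooth_has_vector_derivative:
  "smooth f \<Longrightarrow> (iter_deriv n f has_vector_derivative iter_deriv (Suc n) f x) (at x)"
  by (simp add: smooth_def iter_deriv_Suc vector_derivative_works)

text \<open>Together with \<open>smoothI\<close>, the way closed forms enter: once a sequence
  \<open>D\<close> is guessed, checking a single differentiation step yields both the formula and
  smoothness.\<close>

lemma iter_deriv_eqI:
  assumes "\<And>n x. (D n has_vector_derivative D (Suc n) x) (at x)" and "D 0 = f"
  shows "iter_deriv n f = D n"
proof (induction n)
  case (Suc n)
  show ?case
    by (rule ext) (use assms(1) Suc in \<open>simp add: iter_deriv_Suc vector_derivative_at\<close>)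
qed (simp add: assms)

lemma smoothI:
  assumes "\<And>n x. (D n has_vector_derivative D (Suc n) x) (at x)" and "D 0 = f"
  shows "smooth f"
  unfolding smooth_def iter_deriv_eqI[OF assms]
  using assms(1) differentiableI_vector by blast

lemma
  assumes "smooth f" "smooth g"
  shows iter_deriv_add: "iter_deriv n (\<lambda>x. f x + g x) = (\<lambda>x. iter_deriv n f x + iter_deriv n g x)"
    and smooth_add: "smooth (\<lambda>x. f x + g x)"
proof -
  have *: "((\<lambda>x. iter_deriv n f x + iter_deriv n g x) has_vector_derivative
      iter_deriv (Suc n) f x + iter_deriv (Suc n) g x) (at x)" for n x
    using assms by (intro derivative_intros smooth_has_vector_derivative)
  show "iter_deriv n (\<lambda>x. f x + g x) = (\<lambda>x. iter_deriv n f x + iter_deriv n g x)"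
    by (rule iter_deriv_eqI[where D = "\<lambda>n x. iter_deriv n f x + iter_deriv n g x"]) (use * in auto)
  show "smooth (\<lambda>x. f x + g x)"
    by (rule smoothI[where D = "\<lambda>n x. iter_deriv n f x + iter_deriv n g x"]) (use * in auto)
qed

lemma
  assumes "smooth f"
  shows iter_deriv_scaleR: "iter_deriv n (\<lambda>x. c *\<^sub>R f x) = (\<lambda>x. c *\<^sub>R iter_deriv n f x)"
    and smooth_scaleR: "smooth (\<lambda>x. c *\<^sub>R f x)"
proof -
  have *: "((\<lambda>x. c *\<^sub>R iter_deriv n f x) has_vector_derivative c *\<^sub>R iter_deriv (Suc n) f x) (at x)"
    for n x
    by (rule bounded_linear.has_vector_derivative[OF bounded_linear_scaleR_right
          smooth_has_vector_derivative[OF assms]])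
  show "iter_deriv n (\<lambda>x. c *\<^sub>R f x) = (\<lambda>x. c *\<^sub>R iter_deriv n f x)"
    by (rule iter_deriv_eqI[where D = "\<lambda>n x. c *\<^sub>R iter_deriv n f x"]) (use * in auto)
  show "smooth (\<lambda>x. c *\<^sub>R f x)"
    by (rule smoothI[where D = "\<lambda>n x. c *\<^sub>R iter_deriv n f x"]) (use * in auto)
qed

lemma
  assumes "smooth f" "smooth g"
  shows iter_deriv_diff: "iter_deriv n (\<lambda>x. f x - g x) = (\<lambda>x. iter_deriv n f x - iter_deriv n g x)"
    and smooth_diff: "smooth (\<lambda>x. f x - g x)"
  using iter_deriv_add[OF assms(1) smooth_scaleR[OF assms(2), of "-1"], of n]
    smooth_add[OF assms(1) smooth_scaleR[OF assms(2), of "-1"]]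
  by (simp_all add: iter_deriv_scaleR[OF assms(2), of _ "-1", simplified])

lemma
  shows iter_deriv_const: "iter_deriv n (\<lambda>x. c) = (\<lambda>x. if n = 0 then c else 0)"
    and smooth_const: "smooth (\<lambda>x. c)"
proof -
  have *: "((\<lambda>x. if n = 0 then c else 0) has_vector_derivative (if Suc n = 0 then c else 0)) (at x)"
    for n x by (auto intro!: derivative_eq_intros)
  show "iter_deriv n (\<lambda>x. c) = (\<lambda>x. if n = 0 then c else 0)"
    by (rule iter_deriv_eqI[where D = "\<lambda>n x. if n = 0 then c else 0"]) (use * in auto)
  show "smooth (\<lambda>x. c)"
    by (rule smoothI[where D = "\<lambda>n x. if n = 0 then c else 0"]) (use * in auto)
qed

lemma smooth_deriv: "smooth f \<Longrightarrow> smooth (iter_deriv 1 f)"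
  by (rule smoothI[where D = "\<lambda>n. iter_deriv (Suc n) f"]) (auto simp: smooth_has_vector_derivative)

lemma
  fixes f :: "real \<Rightarrow> real" and g :: "real \<Rightarrow> 'a::real_normed_vector"
  assumes "smooth f" "smooth g"
  shows iter_deriv_mult: "iter_deriv n (\<lambda>x. f x *\<^sub>R g x) =
      (\<lambda>x. \<Sum>k\<le>n. (real (n choose k) * iter_deriv k f x) *\<^sub>R iter_deriv (n - k) g x)"
    and smooth_mult: "smooth (\<lambda>x. f x *\<^sub>R g x)"
proof -
  let ?D = "\<lambda>n x. \<Sum>k\<le>n. (real (n choose k) * iter_deriv k f x) *\<^sub>R iter_deriv (n - k) g x"
  have *: "(?D n has_vector_derivative ?D (Suc n) x) (at x)" for n x
  proof -
    let ?a = "\<lambda>k. iter_deriv k f x" and ?b = "\<lambda>k. iter_deriv k g x"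
    have summand: "((\<lambda>x. (real (n choose k) * iter_deriv k f x) *\<^sub>R iter_deriv (n - k) g x)
       has_vector_derivative (real (n choose k) * ?a k) *\<^sub>R ?b (Suc (n - k))
         + (real (n choose k) * ?a (Suc k)) *\<^sub>R ?b (n - k)) (at x)" for k
      using smooth_has_vector_derivative[OF assms(1), of k x]
        smooth_has_vector_derivative[OF assms(2), of "n - k" x]
      by (intro has_vector_derivative_scaleR) (auto simp: has_real_derivative_iff_has_vector_derivative
         intro!: derivative_eq_intros)
    \<comment> \<open>Pascal's rule splits the shifted sum. The half with
      \<open>n choose Suc k\<close> rejoins the term k = 0, and its top term vanishes because
      \<open>n choose Suc n\<close> is 0.\<close>
    have "?D (Suc n) x = ?a 0 *\<^sub>R ?b (Suc n)
        + (\<Sum>k\<le>n. (real (Suc n choose Suc k) * ?a (Suc k)) *\<^sub>R ?b (n - k))"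
      by (subst sum.atMost_Suc_shift) simp
    also have "\<dots> = ?a 0 *\<^sub>R ?b (Suc n)
        + (\<Sum>k\<le>n. (real (n choose Suc k) * ?a (Suc k)) *\<^sub>R ?b (n - k))
        + (\<Sum>k\<le>n. (real (n choose k) * ?a (Suc k)) *\<^sub>R ?b (n - k))"
      by (simp add: algebra_simps scaleR_add_left sum.distrib)
    also have "?a 0 *\<^sub>R ?b (Suc n) + (\<Sum>k\<le>n. (real (n choose Suc k) * ?a (Suc k)) *\<^sub>R ?b (n - k))
        = (\<Sum>k\<le>Suc n. (real (n choose k) * ?a k) *\<^sub>R ?b (Suc n - k))"
      by (subst sum.atMost_Suc_shift) simp
    also have "\<dots> = (\<Sum>k\<le>n. (real (n choose k) * ?a k) *\<^sub>R ?b (Suc (n - k)))"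
      by (simp add: Suc_diff_le binomial_eq_0)
    finally have "?D (Suc n) x = (\<Sum>k\<le>n. (real (n choose k) * ?a k) *\<^sub>R ?b (Suc (n - k))
         + (real (n choose k) * ?a (Suc k)) *\<^sub>R ?b (n - k))"
      by (simp add: sum.distrib)
    then show ?thesis
      using has_vector_derivative_sum[of "{..n}", OF summand] by simp
  qed
  show "iter_deriv n (\<lambda>x. f x *\<^sub>R g x) = ?D n"
    by (rule iter_deriv_eqI[where D = ?D]) (use * in auto)
  show "smooth (\<lambda>x. f x *\<^sub>R g x)"
    by (rule smoothI[where D = ?D]) (use * in auto)
qed

text \<open>Bell polynomials stay implicit: it is enough that the coefficients are chosen before f
  and that the leading one is known. The first gives continuity of each functional, the second the
  lower bound on test functions. Smoothness of the coefficients lets the induction differentiate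
  them again.\<close>

lemma faa_di_bruno:
  fixes \<psi> :: "real \<Rightarrow> real"
  assumes psi: "smooth \<psi>"
  shows "\<exists>c :: nat \<Rightarrow> real \<Rightarrow> real. (\<forall>k. smooth (c k)) \<and> (\<forall>x. c n x = iter_deriv 1 \<psi> x ^ n) \<and>
    (\<forall>f :: real \<Rightarrow> 'a::real_normed_vector. smooth f \<longrightarrow>
      (\<forall>x. iter_deriv n (f \<circ> \<psi>) x = (\<Sum>k\<le>n. c k x *\<^sub>R iter_deriv k f (\<psi> x))))"
proof (induction n)
  case 0
  show ?case
    by (rule exI[of _ "\<lambda>k x. 1"]) (auto simp: smooth_const)
next
  case (Suc n)
  let ?p = "iter_deriv 1 \<psi>"
  obtain c :: "nat \<Rightarrow> real \<Rightarrow> real" where c: "\<And>k. smooth (c k)" "\<And>x. c n x = ?p x ^ n"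
    "\<And>(f :: real \<Rightarrow> 'a) x. smooth f \<Longrightarrow> iter_deriv n (f \<circ> \<psi>) x = (\<Sum>k\<le>n. c k x *\<^sub>R iter_deriv k f (\<psi> x))"
    using Suc by blast
  \<comment> \<open>The recurrence is c'_k = (c_k)' + \<psi>' c_(k-1). The induction hypothesis
    fixes no values of \<open>c k\<close> for k > n, hence the cut-off; it leaves
    \<open>c' (Suc n)\<close> as the pure product with \<psi>'.\<close>
  define c' where "c' k x = (if k \<le> n then iter_deriv 1 (c k) x else 0)
      + (if k = 0 then 0 else ?p x * c (k - 1) x)" for k x
  have "smooth (c' k)" for k
    using smooth_add[OF smooth_deriv[OF c(1)[of k]] smooth_mult[OF smooth_deriv[OF psi] c(1)[of "k - 1"]]]
      smooth_mult[OF smooth_deriv[OF psi] c(1)[of "k - 1"]] smooth_deriv[OF c(1)[of k]]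
      smooth_const[of "0::real"]
    by (cases "k = 0"; cases "k \<le> n") (simp_all add: c'_def[abs_def])
  moreover have "c' (Suc n) x = ?p x ^ Suc n" for x
    by (simp add: c'_def c)
  moreover have "iter_deriv (Suc n) (f \<circ> \<psi>) x = (\<Sum>k\<le>Suc n. c' k x *\<^sub>R iter_deriv k f (\<psi> x))"
    if f: "smooth f" for f :: "real \<Rightarrow> 'a" and x
  proof -
    have comp: "(iter_deriv k f \<circ> \<psi> has_vector_derivative ?p x *\<^sub>R iter_deriv (Suc k) f (\<psi> x)) (at x)" for k
      using smooth_has_vector_derivative[OF psi, of 0 x] smooth_has_vector_derivative[OF f, of k "\<psi> x"]
      by (intro vector_diff_chain_at) auto
    have "((\<lambda>x. c k x *\<^sub>R iter_deriv k f (\<psi> x)) has_vector_derivative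
        c k x *\<^sub>R ?p x *\<^sub>R iter_deriv (Suc k) f (\<psi> x) + iter_deriv 1 (c k) x *\<^sub>R iter_deriv k f (\<psi> x)) (at x)" for k
      using smooth_has_vector_derivative[OF c(1), of 0 k x] comp[of k]
      by (intro has_vector_derivative_scaleR)
        (auto simp: has_real_derivative_iff_has_vector_derivative o_def)
    then have "((\<lambda>x. \<Sum>k\<le>n. c k x *\<^sub>R iter_deriv k f (\<psi> x)) has_vector_derivative
        (\<Sum>k\<le>n. c k x *\<^sub>R ?p x *\<^sub>R iter_deriv (Suc k) f (\<psi> x) + iter_deriv 1 (c k) x *\<^sub>R iter_deriv k f (\<psi> x))) (at x)"
      by (intro has_vector_derivative_sum)
    then have "iter_deriv (Suc n) (f \<circ> \<psi>) x =
        (\<Sum>k\<le>n. c k x *\<^sub>R ?p x *\<^sub>R iter_deriv (Suc k) f (\<psi> x)) + (\<Sum>k\<le>n. iter_deriv 1 (c k) x *\<^sub>R iter_deriv k f (\<psi> x))"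
      unfolding iter_deriv_Suc c(3)[OF f, abs_def]
      by (simp add: vector_derivative_at sum.distrib flip: c(3)[OF f])
    also have "(\<Sum>k\<le>n. c k x *\<^sub>R ?p x *\<^sub>R iter_deriv (Suc k) f (\<psi> x))
        = (\<Sum>k\<le>Suc n. (if k = 0 then 0 else ?p x * c (k - 1) x) *\<^sub>R iter_deriv k f (\<psi> x))"
      by (subst sum.atMost_Suc_shift) (simp add: mult.commute)
    also have "(\<Sum>k\<le>n. iter_deriv 1 (c k) x *\<^sub>R iter_deriv k f (\<psi> x))
        = (\<Sum>k\<le>Suc n. (if k \<le> n then iter_deriv 1 (c k) x else 0) *\<^sub>R iter_deriv k f (\<psi> x))"
      by simp
    finally show ?thesis
      by (simp only: c'_def scaleR_add_left sum.distrib add.commute)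
  qed
  ultimately show ?case by blast
qed

text \<open>The part of completeness that concerns smoothness. The rate is uniform in x, so each
  derivative converges uniformly and the limit may be differentiated term by term; its dependence on
  j through \<open>A j\<close> is arbitrary.\<close>

lemma smooth_limit:
  fixes F :: "nat \<Rightarrow> real \<Rightarrow> 'a::banach"
  assumes smooth: "\<And>n. smooth (F n)"
    and Cauchy: "\<And>j x m n. n \<le> m \<Longrightarrow> norm (iter_deriv j (F m) x - iter_deriv j (F n) x) \<le> A j * r n"
    and r: "r \<longlonglongrightarrow> (0::real)"
  obtains G where "smooth G" "\<And>j x. (\<lambda>n. iter_deriv j (F n) x) \<longlonglongrightarrow> iter_deriv j G x"
proof -
  define L where "L j x = lim (\<lambda>n. iter_deriv j (F n) x)" for j x
  have small: "\<forall>\<^sub>F n in sequentially. A j * r n < e" if "e > 0" for e j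
    using order_tendstoD(2)[OF tendsto_mult_left[OF r, of "A j"]] that by simp
  have lim: "(\<lambda>n. iter_deriv j (F n) x) \<longlonglongrightarrow> L j x" for j x
  proof -
    have "Cauchy (\<lambda>n. iter_deriv j (F n) x)"
    proof (rule CauchyI')
      fix e :: real assume "e > 0"
      then obtain N where "A j * r n < e" if "n \<ge> N" for n
        using small[of e j] by (auto simp: eventually_sequentially)
      then show "\<exists>M. \<forall>m\<ge>M. \<forall>n>m. dist (iter_deriv j (F m) x) (iter_deriv j (F n) x) < e"
        using Cauchy[of _ _ j x] by (metis dist_norm norm_minus_commute less_imp_le le_less_trans)
    qed
    then show ?thesis
      by (simp add: L_def Cauchy_convergent_iff convergent_LIMSEQ_iff)
  qed
  have close: "norm (iter_deriv j (F n) x - L j x) \<le> A j * r n" for j n x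
  proof -
    have "(\<lambda>m. norm (iter_deriv j (F m) x - iter_deriv j (F n) x)) \<longlonglongrightarrow> norm (L j x - iter_deriv j (F n) x)"
      by (intro tendsto_intros lim)
    then have "norm (L j x - iter_deriv j (F n) x) \<le> A j * r n"
      by (rule LIMSEQ_le_const2) (use Cauchy in blast)
    then show ?thesis by (simp add: norm_minus_commute)
  qed
  have deriv: "(L j has_vector_derivative L (Suc j) x) (at x)" for j x
  proof -
    have "\<exists>g. \<forall>x\<in>UNIV. (\<lambda>n. iter_deriv j (F n) x) \<longlonglongrightarrow> g x \<and>
        (g has_derivative (\<lambda>h. h *\<^sub>R L (Suc j) x)) (at x within UNIV)"
    proof (rule has_derivative_sequence)
      show "(iter_deriv j (F n) has_derivative (\<lambda>h. h *\<^sub>R iter_deriv (Suc j) (F n) x)) (at x within UNIV)" for n x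
        using smooth_has_vector_derivative[OF smooth] by (simp add: has_vector_derivative_def)
      show "\<forall>\<^sub>F n in sequentially. \<forall>x\<in>UNIV. \<forall>h. norm (h *\<^sub>R iter_deriv (Suc j) (F n) x - h *\<^sub>R L (Suc j) x) \<le> e * norm h"
        if "e > 0" for e
        using small[OF that, of "Suc j"]
      proof eventually_elim
        case (elim n)
        have "norm (iter_deriv (Suc j) (F n) x - L (Suc j) x) \<le> e" for x
          using close[of "Suc j" n x] elim by linarith
        then have "norm h * norm (iter_deriv (Suc j) (F n) x - L (Suc j) x) \<le> norm h * e" for x and h :: real
          by (intro mult_left_mono) auto
        then show ?case
          by (simp add: mult.commute flip: scaleR_diff_right)
      qed
    qed (use lim in auto)
    then obtain g where g: "\<And>x. (\<lambda>n. iter_deriv j (F n) x) \<longlonglongrightarrow> g x"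
      "\<And>x. (g has_derivative (\<lambda>h. h *\<^sub>R L (Suc j) x)) (at x)"
      by auto
    moreover have "g = L j"
      using LIMSEQ_unique[OF g(1) lim] by auto
    ultimately show ?thesis
      by (simp add: has_vector_derivative_def)
  qed
  show thesis
    using that[of "L 0"] smoothI[of L, OF deriv] iter_deriv_eqI[of L, OF deriv] lim by simp
qed

section \<open>The seminorms of the Gelfand-Shilov space\<close>

text \<open>The inequality p_h(f) \<le> B as a relation: no supremum is formed, so bounds add, scale
  and pass to limits without a finiteness side condition.\<close>

definition gs_bound :: "real \<Rightarrow> real \<Rightarrow> real \<Rightarrow> (real \<Rightarrow> complex) \<Rightarrow> bool" where
  "gs_bound d h B f \<longleftrightarrow> (\<forall>x j l. norm (x ^ l *\<^sub>R iter_deriv j f x) \<le> B * (h ^ (j + l) * fact (j + l) powr d))"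

lemma gelfand_shilov_iff:
  "f \<in> gelfand_shilov d \<longleftrightarrow> smooth f \<and> (\<forall>h>0. \<exists>B. gs_bound d h B f)"
proof -
  have "bdd_above (range (\<lambda>(x, j, l).
        norm (x ^ l *\<^sub>R iter_deriv j f x) / (h ^ (j + l) * fact (j + l) powr d))) \<longleftrightarrow> (\<exists>B. gs_bound d h B f)"
    if "h > 0" for h
  proof -
    have "h ^ n * fact n powr d > 0" for n
      using that by simp
    then show ?thesis
      by (auto simp: bdd_above_def gs_bound_def pos_divide_le_eq)
  qed
  then show ?thesis
    by (auto simp: gelfand_shilov_def)
qed

lemma gs_bound_iter_deriv: "gs_bound d h B f \<Longrightarrow> norm (iter_deriv j f x) \<le> B * (h ^ j * fact j powr d)"
  unfolding gs_bound_def by (drule spec[of _ x], drule spec[of _ j], drule spec[of _ 0]) simp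

lemma gs_bound_nonneg: "gs_bound d h B f \<Longrightarrow> B \<ge> 0"
  unfolding gs_bound_def
  by (drule spec[of _ 0], drule spec[of _ 0], drule spec[of _ 0]) (simp add: order_trans[OF norm_ge_zero])

lemma gs_bound_mono:
  assumes "gs_bound d h B f" "B \<le> B'" "0 < h" "h \<le> h'"
  shows "gs_bound d h' B' f"
proof -
  have "B * (h ^ n * fact n powr d) \<le> B' * (h' ^ n * fact n powr d)" for n
    using assms gs_bound_nonneg[OF assms(1)] by (intro mult_mono power_mono) auto
  then show ?thesis
    using assms(1) unfolding gs_bound_def by (meson order_trans)
qed

lemma gs_bound_add:
  assumes "smooth f" "smooth g" "gs_bound d h A f" "gs_bound d h B g"
  shows "gs_bound d h (A + B) (\<lambda>x. f x + g x)"
  using assms(3,4) unfolding gs_bound_def iter_deriv_add[OF assms(1,2)]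
  by (auto simp: scaleR_add_right distrib_right intro!: norm_triangle_le add_mono)

lemma gs_bound_scaleR:
  assumes "smooth f" "gs_bound d h B f"
  shows "gs_bound d h (\<bar>c\<bar> * B) (\<lambda>x. c *\<^sub>R f x)"
  unfolding gs_bound_def iter_deriv_scaleR[OF assms(1)]
proof (intro allI)
  fix x :: real and j l :: nat
  have "norm (x ^ l *\<^sub>R c *\<^sub>R iter_deriv j f x) = \<bar>c\<bar> * norm (x ^ l *\<^sub>R iter_deriv j f x)"
    by (simp add: abs_mult)
  also have "\<dots> \<le> \<bar>c\<bar> * (B * (h ^ (j + l) * fact (j + l) powr d))"
    using assms(2) by (intro mult_left_mono) (auto simp: gs_bound_def)
  finally show "norm (x ^ l *\<^sub>R c *\<^sub>R iter_deriv j f x) \<le> \<bar>c\<bar> * B * (h ^ (j + l) * fact (j + l) powr d)"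
    by (simp add: mult.assoc)
qed

lemma gelfand_shilov_smooth: "f \<in> gelfand_shilov d \<Longrightarrow> smooth f"
  by (simp add: gelfand_shilov_iff)

lemma gelfand_shilovE:
  assumes "f \<in> gelfand_shilov d" "h > 0"
  obtains B where "gs_bound d h B f"
  using assms by (auto simp: gelfand_shilov_iff)

lemma gelfand_shilov_add:
  "f \<in> gelfand_shilov d \<Longrightarrow> g \<in> gelfand_shilov d \<Longrightarrow> (\<lambda>x. f x + g x) \<in> gelfand_shilov d"
  unfolding gelfand_shilov_iff by (blast intro: gs_bound_add smooth_add)

lemma gelfand_shilov_scaleR: "f \<in> gelfand_shilov d \<Longrightarrow> (\<lambda>x. c *\<^sub>R f x) \<in> gelfand_shilov d"
  unfolding gelfand_shilov_iff by (blast intro: gs_bound_scaleR smooth_scaleR)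

lemma gelfand_shilov_zero: "(\<lambda>x. 0) \<in> gelfand_shilov d"
proof -
  have "gs_bound d h 0 (\<lambda>x. 0)" for h
    by (simp add: gs_bound_def iter_deriv_const)
  then show ?thesis
    by (auto simp: gelfand_shilov_iff smooth_const)
qed

text \<open>Each inequality inside \<open>gs_bound\<close> concerns one derivative at one point, so
  pointwise convergence suffices and the constant survives.\<close>

lemma gs_bound_limit:
  assumes "\<forall>\<^sub>F n in sequentially. gs_bound d h B (F n)"
    and "\<And>j x. (\<lambda>n. iter_deriv j (F n) x) \<longlonglongrightarrow> iter_deriv j G x"
  shows "gs_bound d h B G"
  unfolding gs_bound_def
proof (intro allI)
  fix x :: real and j l :: nat
  have "(\<lambda>n. norm (x ^ l *\<^sub>R iter_deriv j (F n) x)) \<longlonglongrightarrow> norm (x ^ l *\<^sub>R iter_deriv j G x)"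
    by (intro tendsto_intros assms)
  moreover have "\<forall>\<^sub>F n in sequentially. norm (x ^ l *\<^sub>R iter_deriv j (F n) x) \<le> B * (h ^ (j + l) * fact (j + l) powr d)"
    using assms(1) by (rule eventually_mono) (simp add: gs_bound_def)
  ultimately show "norm (x ^ l *\<^sub>R iter_deriv j G x) \<le> B * (h ^ (j + l) * fact (j + l) powr d)"
    by (intro tendsto_upperbound) auto
qed


section \<open>Uniform boundedness\<close>

text \<open>Banach--Steinhaus on the Frechet space \<open>gelfand_shilov d\<close>, by a gliding hump in which the sign of each
  hump is chosen so that it cannot cancel against the previous partial sum (Sokal's argument).\<close>

lemma gelfand_shilov_uniform_boundedness:
  fixes T :: "'i \<Rightarrow> (real \<Rightarrow> complex) \<Rightarrow> 'b::real_normed_vector"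
  assumes add: "\<And>i f g. f \<in> gelfand_shilov d \<Longrightarrow> g \<in> gelfand_shilov d \<Longrightarrow> T i (\<lambda>x. f x + g x) = T i f + T i g"
    and scale: "\<And>i f c. f \<in> gelfand_shilov d \<Longrightarrow> T i (\<lambda>x. c *\<^sub>R f x) = c *\<^sub>R T i f"
    and cont: "\<And>i. \<exists>E. \<forall>f B. f \<in> gelfand_shilov d \<longrightarrow> gs_bound d 1 B f \<longrightarrow> norm (T i f) \<le> E * B"
    and pointwise: "\<And>f. f \<in> gelfand_shilov d \<Longrightarrow> \<exists>M. \<forall>i. norm (T i f) \<le> M"
  shows "\<exists>h>0. \<exists>C. \<forall>i f B. f \<in> gelfand_shilov d \<longrightarrow> gs_bound d h B f \<longrightarrow> norm (T i f) \<le> C * B"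
proof (rule ccontr)
  let ?S = "gelfand_shilov d"
  assume "\<not> ?thesis"
  then have neg: "\<exists>i f B. f \<in> ?S \<and> gs_bound d h B f \<and> norm (T i f) > C * B" if "h > 0" for h C
    using that by (meson not_le)
  have hump: "\<exists>i f. f \<in> ?S \<and> gs_bound d h \<delta> f \<and> norm (T i f) = N"
    if pos: "h > 0" "\<delta> > 0" "N > 0" for h \<delta> N
  proof -
    \<comment> \<open>Violating the estimate with constant \<open>N / \<delta>\<close> leaves
      exactly the room to rescale f to image norm N while its seminorm bound drops to
      \<delta>.\<close>
    obtain i f B where f: "f \<in> ?S" "gs_bound d h B f" "norm (T i f) > N / \<delta> * B"
      using neg[OF pos(1)] by blast
    have B: "B \<ge> 0"
      by (rule gs_bound_nonneg[OF f(2)])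
    have T_pos: "norm (T i f) > 0"
      using f(3) B pos by (meson le_less_trans mult_nonneg_nonneg divide_nonneg_nonneg less_imp_le)
    define c where "c = N / norm (T i f)"
    have "\<bar>c\<bar> * B \<le> \<delta>"
      using f(3) pos T_pos by (simp add: c_def field_simps)
    then have "gs_bound d h \<delta> (\<lambda>x. c *\<^sub>R f x)"
      using gs_bound_mono[OF gs_bound_scaleR[OF gelfand_shilov_smooth[OF f(1)] f(2)]] pos by blast
    moreover have "norm (T i (\<lambda>x. c *\<^sub>R f x)) = N"
      using pos T_pos by (simp add: scale[OF f(1)] c_def)
    ultimately show ?thesis
      using gelfand_shilov_scaleR[OF f(1)] by blast
  qed
  have step: "\<exists>i F'. F' \<in> ?S \<and> gs_bound d h \<delta> (\<lambda>x. F' x - F x) \<and> norm (T i F') \<ge> N"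
    if F: "F \<in> ?S" and pos: "h > 0" "\<delta> > 0" "N > 0" for h \<delta> N F
  proof -
    obtain i f where f: "f \<in> ?S" "gs_bound d h \<delta> f" "norm (T i f) = N"
      using hump[OF pos] by blast
    define g where "g = (\<lambda>x. (-1) *\<^sub>R f x)"
    have g: "g \<in> ?S" "gs_bound d h \<delta> g" "T i g = - T i f"
      using gelfand_shilov_scaleR[OF f(1), of "-1"] gs_bound_scaleR[OF gelfand_shilov_smooth[OF f(1)] f(2), of "-1"]
        scale[OF f(1), of i "-1"] unfolding g_def by simp_all
    \<comment> \<open>The two candidates have images differing by \<open>2 *\<^sub>R T i f\<close>,
      of norm 2 N, so they cannot both have norm below N.\<close>
    have "norm ((T i F + T i f) - (T i F + T i g)) \<le> norm (T i F + T i f) + norm (T i F + T i g)"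
      by (rule norm_triangle_ineq4)
    moreover have "(T i F + T i f) - (T i F + T i g) = 2 *\<^sub>R T i f"
      by (simp add: g scaleR_2)
    ultimately have "norm (T i F + T i f) \<ge> N \<or> norm (T i F + T i g) \<ge> N"
      using f(3) by auto
    then show ?thesis
    proof
      assume "norm (T i F + T i f) \<ge> N"
      then show ?thesis
        using gelfand_shilov_add[OF F f(1)] f(2) add[OF F f(1)]
        by (intro exI[of _ i] exI[of _ "\<lambda>x. F x + f x"]) simp
    next
      assume "norm (T i F + T i g) \<ge> N"
      then show ?thesis
        using gelfand_shilov_add[OF F g(1)] g(2) add[OF F g(1)]
        by (intro exI[of _ i] exI[of _ "\<lambda>x. F x + g x"]) simp
    qed
  qed
  obtain E0 where E0: "\<And>i f B. f \<in> ?S \<Longrightarrow> gs_bound d 1 B f \<Longrightarrow> norm (T i f) \<le> E0 i * B"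
    using cont by metis
  define E where "E i = max 1 (E0 i)" for i
  have E_pos: "E i > 0" for i
    by (simp add: E_def)
  have E: "norm (T i f) \<le> E i * B" if "f \<in> ?S" "gs_bound d 1 B f" for i f B
    by (rule order_trans[OF E0[OF that] mult_right_mono])
      (use gs_bound_nonneg[OF that(2)] in \<open>auto simp: E_def\<close>)
  \<comment> \<open>A state holds the partial sum F, the index i of the functional made large at F,
    and a budget \<delta> for the next hump. Budgets at least halve, so all later humps together
    cost at most 2 \<delta>, and \<open>2 * E i * \<delta> \<le> 1\<close> keeps them from moving
    \<open>T i\<close> by more than 1. The parameter \<open>inverse (real (Suc n))\<close> tends to
    0, so every seminorm is eventually controlled.\<close>
  define P where "P n = (\<lambda>(F, i :: 'i, \<delta>). F \<in> ?S \<and> \<delta> > 0 \<and> 2 * E i * \<delta> \<le> 1)" for n :: nat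
  define Q where "Q n = (\<lambda>(F, i :: 'i, \<delta>) (F', i' :: 'i, \<delta>'). gs_bound d (inverse (real (Suc n))) \<delta> (\<lambda>x. F' x - F x)
     \<and> norm (T i' F') \<ge> real (Suc n) \<and> 2 * \<delta>' \<le> \<delta>)" for n :: nat
  have "\<exists>s. \<forall>n. P n (s n) \<and> Q n (s n) (s (Suc n))"
  proof (rule dependent_nat_choice)
    show "\<exists>s. P 0 s"
    proof -
      have "P 0 (\<lambda>x. 0, i, 1 / (2 * E i))" for i
        using E_pos[of i] by (simp add: P_def gelfand_shilov_zero)
      then show ?thesis by blast
    qed
    show "\<exists>s'. P (Suc n) s' \<and> Q n s s'" if "P n s" for n s
    proof -
      obtain F i \<delta> where s_eq: "s = (F, i, \<delta>)"
        by (rule prod_cases3)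
      then have s: "F \<in> ?S" "\<delta> > 0"
        using that by (auto simp: P_def)
      obtain i' F' where F': "F' \<in> ?S" "gs_bound d (inverse (real (Suc n))) \<delta> (\<lambda>x. F' x - F x)"
        "norm (T i' F') \<ge> real (Suc n)"
        using step[OF s(1) _ s(2), of "inverse (real (Suc n))" "real (Suc n)"] by auto
      define \<delta>' where "\<delta>' = min (\<delta> / 2) (1 / (2 * E i'))"
      have "2 * E i' * \<delta>' \<le> 2 * E i' * (1 / (2 * E i'))"
        using E_pos[of i'] by (intro mult_left_mono) (auto simp: \<delta>'_def)
      then have "2 * E i' * \<delta>' \<le> 1" "\<delta>' > 0" "2 * \<delta>' \<le> \<delta>"
        using E_pos[of i'] s(2) by (auto simp: \<delta>'_def)
      then show ?thesis
        using F' by (intro exI[of _ "(F', i', \<delta>')"]) (simp add: P_def Q_def s_eq)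
    qed
  qed
  then obtain s where s: "\<And>n. P n (s n)" "\<And>n. Q n (s n) (s (Suc n))"
    by blast
  define F where "F n = fst (s n)" for n
  define i where "i n = fst (snd (s n))" for n
  define \<delta> where "\<delta> n = snd (snd (s n))" for n
  have s_eq: "s n = (F n, i n, \<delta> n)" for n
    by (simp add: F_def i_def \<delta>_def)
  have F: "F n \<in> ?S" and \<delta>_pos: "\<delta> n > 0" and E\<delta>: "2 * E (i n) * \<delta> n \<le> 1" for n
    using s(1)[of n] unfolding s_eq by (auto simp: P_def)
  have F_step: "gs_bound d (inverse (real (Suc n))) (\<delta> n) (\<lambda>x. F (Suc n) x - F n x)"
    and T_large: "norm (T (i (Suc n)) (F (Suc n))) \<ge> real (Suc n)" and \<delta>_step: "2 * \<delta> (Suc n) \<le> \<delta> n" for n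
    using s(2)[of n] unfolding s_eq by (auto simp: Q_def)
  have smooth: "smooth (F n)" for n
    using F by (rule gelfand_shilov_smooth)
  have smooth': "smooth (\<lambda>x. F m x - F n x)" for m n
    by (intro smooth_diff smooth)
  \<comment> \<open>The subtracted \<open>2 * \<delta> m\<close> makes the induction close: the next
    hump adds \<open>\<delta> m\<close>, which halving the budget gives back.\<close>
  have tele: "gs_bound d (inverse (real (Suc n))) (2 * \<delta> n - 2 * \<delta> m) (\<lambda>x. F m x - F n x)" if "n \<le> m" for n m
    using that
  proof (induction m rule: dec_induct)
    case base
    show ?case by (simp add: gs_bound_def iter_deriv_const)
  next
    case (step m)
    have "gs_bound d (inverse (real (Suc n))) (\<delta> m) (\<lambda>x. F (Suc m) x - F m x)"
      by (rule gs_bound_mono[OF F_step]) (use step in auto)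
    from gs_bound_add[OF smooth' smooth' step.IH this]
    have "gs_bound d (inverse (real (Suc n))) (2 * \<delta> n - 2 * \<delta> m + \<delta> m) (\<lambda>x. F (Suc m) x - F n x)"
      by simp
    then show ?case
      by (rule gs_bound_mono) (use \<delta>_step[of m] in auto)
  qed
  have near: "gs_bound d h (2 * \<delta> n) (\<lambda>x. F m x - F n x)" if "n \<le> m" "inverse (real (Suc n)) \<le> h" for n m h
    by (rule gs_bound_mono[OF tele]) (use that \<delta>_pos[of m] in auto)
  have near1: "gs_bound d 1 (2 * \<delta> n) (\<lambda>x. F m x - F n x)" if "n \<le> m" for n m
    by (rule near[OF that]) (simp add: inverse_le_1_iff)
  have \<delta>_le: "\<delta> n \<le> \<delta> 0 * (1 / 2) ^ n" for n
  proof (induction n)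
    case (Suc n)
    then show ?case using \<delta>_step[of n] by simp
  qed simp
  have \<delta>_lim: "(\<lambda>n. 2 * \<delta> n) \<longlonglongrightarrow> 0"
  proof (rule tendsto_sandwich[where f = "\<lambda>_. 0"])
    show "(\<lambda>n. 2 * (\<delta> 0 * (1 / 2) ^ n)) \<longlonglongrightarrow> 0"
      by (auto intro!: tendsto_mult_right_zero LIMSEQ_power_zero)
  qed (use \<delta>_le \<delta>_pos in \<open>auto intro!: always_eventually simp: less_imp_le\<close>)
  obtain G where G: "smooth G" "\<And>j x. (\<lambda>n. iter_deriv j (F n) x) \<longlonglongrightarrow> iter_deriv j G x"
  proof (rule smooth_limit[where F = F and A = "\<lambda>j. fact j powr d" and r = "\<lambda>n. 2 * \<delta> n"])
    show "norm (iter_deriv j (F m) x - iter_deriv j (F n) x) \<le> fact j powr d * (2 * \<delta> n)"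
      if "n \<le> m" for j x m n
      using gs_bound_iter_deriv[OF near1[OF that], of j x]
      by (simp add: mult.commute iter_deriv_diff[OF smooth smooth])
  qed (use smooth \<delta>_lim in auto)
  have G_near: "gs_bound d h (2 * \<delta> n) (\<lambda>x. G x - F n x)" if "inverse (real (Suc n)) \<le> h" for n h
  proof (rule gs_bound_limit)
    show "\<forall>\<^sub>F m in sequentially. gs_bound d h (2 * \<delta> n) (\<lambda>x. F m x - F n x)"
      using near that by (auto simp: eventually_sequentially)
    show "(\<lambda>m. iter_deriv j (\<lambda>x. F m x - F n x) x) \<longlonglongrightarrow> iter_deriv j (\<lambda>x. G x - F n x) x" for j x
      unfolding iter_deriv_diff[OF smooth smooth] iter_deriv_diff[OF G(1) smooth]
      by (intro tendsto_intros G(2))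
  qed
  have "G \<in> ?S"
    unfolding gelfand_shilov_iff
  proof (intro conjI allI impI G(1))
    fix h :: real assume "h > 0"
    then obtain n where n: "inverse (real (Suc n)) \<le> h"
      using reals_Archimedean less_imp_le by blast
    obtain B where "gs_bound d h B (F n)"
      using gelfand_shilovE[OF F \<open>h > 0\<close>] .
    from gs_bound_add[OF smooth_diff[OF G(1) smooth] smooth G_near[OF n] this]
    show "\<exists>B. gs_bound d h B G" by auto
  qed
  then obtain M where M: "\<And>i. norm (T i G) \<le> M"
    using pointwise by blast
  obtain n where n: "real n > M"
    using reals_Archimedean2 by blast
  \<comment> \<open>At \<open>F (Suc n)\<close> the functional has norm at least n + 1 and the
    remainder takes away at most 1, which leaves at least n > M.\<close>
  let ?r = "\<lambda>x. G x - F (Suc n) x"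
  have r: "?r \<in> ?S"
    using gelfand_shilov_add[OF \<open>G \<in> ?S\<close> gelfand_shilov_scaleR[OF F[of "Suc n"], of "-1"]] by simp
  have "norm (T (i (Suc n)) ?r) \<le> E (i (Suc n)) * (2 * \<delta> (Suc n))"
    using r G_near[of "Suc n" 1] by (intro E) (auto simp: inverse_le_1_iff)
  then have "norm (T (i (Suc n)) ?r) \<le> 1"
    using E\<delta>[of "Suc n"] by (simp add: mult_ac)
  moreover have "T (i (Suc n)) G = T (i (Suc n)) ?r + T (i (Suc n)) (F (Suc n))"
    using add[OF r F[of "Suc n"], of "i (Suc n)"] by simp
  then have "norm (T (i (Suc n)) (F (Suc n))) \<le> norm (T (i (Suc n)) G) + norm (T (i (Suc n)) ?r)"
    by (metis add_diff_cancel_left' norm_triangle_ineq4)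
  ultimately show False
    using T_large[of n] M[of "i (Suc n)"] n by simp
qed

section \<open>Factorial growth and the Gaussian\<close>

text \<open>A single term of the exponential series. It serves both the decay of the Gaussian and
  the bound on the oscillating factor.\<close>

lemma power_le_exp_fact:
  fixes x :: real
  assumes "x \<ge> 0"
  shows "x ^ n \<le> exp x * fact n"
proof -
  have "(\<Sum>k\<in>{n}. inverse (fact k) * x ^ k) \<le> exp x"
    unfolding exp_def real_scaleR_def
    by (rule sum_le_suminf) (use assms summable_exp in auto)
  then show ?thesis by (simp add: field_simps)
qed

lemma power_powr_commute: "((x::real) ^ n) powr a = (x powr a) ^ n"
  by (induction n) (auto simp: powr_mult)

text \<open>Any positive power of the factorial beats geometric growth: apply the preceding estimate
  to (a / h) to the power 1 / \<epsilon> and raise it to the power \<epsilon>.\<close>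

lemma power_le_fact_powr:
  fixes a h \<epsilon> :: real
  assumes "a \<ge> 0" "h > 0" "\<epsilon> > 0"
  obtains A where "A \<ge> 0" "\<And>n. a ^ n \<le> A * (h ^ n * fact n powr \<epsilon>)"
proof
  let ?b = "(a / h) powr (1 / \<epsilon>)"
  show "exp ?b powr \<epsilon> \<ge> 0" by simp
  show "a ^ n \<le> exp ?b powr \<epsilon> * (h ^ n * fact n powr \<epsilon>)" for n
  proof -
    have "(?b ^ n) powr \<epsilon> \<le> (exp ?b * fact n) powr \<epsilon>"
      using assms by (intro powr_mono2 power_le_exp_fact) auto
    moreover have "(?b ^ n) powr \<epsilon> = (?b powr \<epsilon>) ^ n"
      by (rule power_powr_commute)
    moreover have "?b powr \<epsilon> = a / h"
      using assms by (simp add: powr_powr)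
    ultimately show ?thesis
      using assms by (simp add: powr_mult field_simps)
  qed
qed

text \<open>The Hermite recurrence: the value is (-1)^n H_n(x) exp(-x^2) with the physicists'
  Hermite polynomials H_n.\<close>

fun gauss_deriv :: "nat \<Rightarrow> real \<Rightarrow> complex" where
  "gauss_deriv 0 x = of_real (exp (- x\<^sup>2))"
| "gauss_deriv (Suc 0) x = (- 2 * x) *\<^sub>R gauss_deriv 0 x"
| "gauss_deriv (Suc (Suc n)) x =
     (- 2 * x) *\<^sub>R gauss_deriv (Suc n) x - (2 * real (Suc n)) *\<^sub>R gauss_deriv n x"

lemma gauss_deriv: "(gauss_deriv n has_vector_derivative gauss_deriv (Suc n) x) (at x)"
proof (induction n rule: less_induct)
  case (less n)
  consider "n = 0" | "n = 1" | m where "n = Suc (Suc m)"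
    by (metis One_nat_def not0_implies_Suc)
  then show ?case
  proof cases
    case 1
    have "((\<lambda>x. complex_of_real (exp (- x\<^sup>2))) has_vector_derivative of_real (exp (- x\<^sup>2) * (- 2 * x))) (at x)"
      by (intro has_vector_derivative_of_real)
        (auto intro!: derivative_eq_intros simp flip: has_real_derivative_iff_has_vector_derivative)
    moreover have "gauss_deriv 0 = (\<lambda>x. complex_of_real (exp (- x\<^sup>2)))"
      by (rule ext) simp
    ultimately show ?thesis
      using 1 by (simp add: scaleR_conv_of_real mult.commute)
  next
    case 2
    have "((\<lambda>x. (- 2 * x) *\<^sub>R gauss_deriv 0 x) has_vector_derivative
        (- 2 * x) *\<^sub>R gauss_deriv (Suc 0) x + (- 2) *\<^sub>R gauss_deriv 0 x) (at x)"
      using less[of 0] 2 by (intro has_vector_derivative_scaleR) (auto intro!: derivative_eq_intros)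
    moreover have "gauss_deriv (Suc 0) = (\<lambda>x. (- 2 * x) *\<^sub>R gauss_deriv 0 x)"
      by (rule ext) simp
    ultimately show ?thesis
      using 2 by simp
  next
    case 3
    have "((\<lambda>x. (- 2 * x) *\<^sub>R gauss_deriv (Suc m) x - (2 * real (Suc m)) *\<^sub>R gauss_deriv m x) has_vector_derivative
        ((- 2 * x) *\<^sub>R gauss_deriv (Suc (Suc m)) x + (- 2) *\<^sub>R gauss_deriv (Suc m) x)
         - (2 * real (Suc m)) *\<^sub>R gauss_deriv (Suc m) x) (at x)"
      using less[of m] less[of "Suc m"] 3
      by (intro has_vector_derivative_diff has_vector_derivative_scaleR
            bounded_linear.has_vector_derivative[OF bounded_linear_scaleR_right])
        (auto intro!: derivative_eq_intros)
    moreover have "gauss_deriv (Suc (Suc m)) =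
        (\<lambda>x. (- 2 * x) *\<^sub>R gauss_deriv (Suc m) x - (2 * real (Suc m)) *\<^sub>R gauss_deriv m x)"
      by (rule ext) simp
    moreover have "(- 2 * x) *\<^sub>R gauss_deriv (Suc (Suc m)) x + (- 2) *\<^sub>R gauss_deriv (Suc m) x
         - (2 * real (Suc m)) *\<^sub>R gauss_deriv (Suc m) x
       = (- 2 * x) *\<^sub>R gauss_deriv (Suc (Suc m)) x - (2 * real (Suc (Suc m))) *\<^sub>R gauss_deriv (Suc m) x"
      unfolding of_nat_Suc by (simp add: algebra_simps del: gauss_deriv.simps)
    ultimately show ?thesis
      unfolding 3 gauss_deriv.simps(3)[of "Suc m"] by metis
  qed
qed

text \<open>The recurrence trades a derivative for a power of x, so the induction runs over all l,
  and a derivative is charged two factors of 3 against one for a power of x. The base 3 works since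
  2 * 3^3 + 2 \<le> 3^4; base 2 would fail here. The factor \<open>exp 1\<close> bounds
  \<open>exp (\<bar>x\<bar> - x\<^sup>2)\<close>.\<close>

lemma norm_gauss_deriv_le: "norm (x ^ l *\<^sub>R gauss_deriv k x) \<le> exp 1 * 3 ^ (2 * k + l) * fact (k + l)"
proof (induction k x arbitrary: l rule: gauss_deriv.induct)
  case (1 x)
  have "norm (x ^ l *\<^sub>R gauss_deriv 0 x) = \<bar>x\<bar> ^ l * exp (- x\<^sup>2)"
    by (simp add: power_abs)
  also have "\<dots> \<le> (exp \<bar>x\<bar> * fact l) * exp (- x\<^sup>2)"
    by (intro mult_right_mono power_le_exp_fact) auto
  also have "\<dots> = exp (\<bar>x\<bar> - x\<^sup>2) * fact l"
    by (simp add: exp_diff exp_minus field_simps)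
  also have "\<dots> \<le> exp 1 * fact l"
  proof -
    have "0 \<le> (\<bar>x\<bar> - 1 / 2)\<^sup>2" by simp
    then have "\<bar>x\<bar> - x\<^sup>2 \<le> 1" by (simp add: power2_diff power_divide)
    then show ?thesis by (intro mult_right_mono) auto
  qed
  also have "\<dots> \<le> exp 1 * 3 ^ l * fact l"
    by (intro mult_right_mono) auto
  finally show ?case by simp
next
  case (2 x)
  have "norm (x ^ l *\<^sub>R gauss_deriv (Suc 0) x) = 2 * norm (x ^ Suc l *\<^sub>R gauss_deriv 0 x)"
    by (simp add: abs_mult)
  also have "\<dots> \<le> 2 * (exp 1 * 3 ^ (2 * 0 + Suc l) * fact (0 + Suc l))"
    by (intro mult_left_mono 2) auto
  also have "\<dots> \<le> exp 1 * 3 ^ (2 * Suc 0 + l) * fact (Suc 0 + l)"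
    by (simp add: mult_mono)
  finally show ?case .
next
  case (3 n x)
  let ?f = "fact (Suc (Suc n) + l) :: real"
  have "x ^ l *\<^sub>R gauss_deriv (Suc (Suc n)) x
     = (-2) *\<^sub>R (x ^ Suc l *\<^sub>R gauss_deriv (Suc n) x) - (2 * real (Suc n)) *\<^sub>R (x ^ l *\<^sub>R gauss_deriv n x)"
    unfolding gauss_deriv.simps(3) by (simp add: scaleR_diff_right mult_ac del: gauss_deriv.simps)
  then have "norm (x ^ l *\<^sub>R gauss_deriv (Suc (Suc n)) x)
     \<le> norm ((-2) *\<^sub>R (x ^ Suc l *\<^sub>R gauss_deriv (Suc n) x))
       + norm ((2 * real (Suc n)) *\<^sub>R (x ^ l *\<^sub>R gauss_deriv n x))"
    by (simp only: norm_triangle_ineq4)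
  also have "\<dots> = 2 * norm (x ^ Suc l *\<^sub>R gauss_deriv (Suc n) x) + 2 * (real (Suc n) * norm (x ^ l *\<^sub>R gauss_deriv n x))"
    unfolding norm_scaleR[of "-2"] norm_scaleR[of "2 * real (Suc n)"] by simp
  also have "\<dots> \<le> 2 * (exp 1 * 3 ^ (2 * Suc n + Suc l) * fact (Suc n + Suc l))
      + 2 * (real (Suc n) * (exp 1 * 3 ^ (2 * n + l) * fact (n + l)))"
    by (intro add_mono mult_left_mono 3) auto
  also have "\<dots> = exp 1 * 3 ^ (2 * n + l) * (54 * ?f + 2 * (real (Suc n) * fact (n + l)))"
    by (simp add: algebra_simps power_add)
  also have "\<dots> \<le> exp 1 * 3 ^ (2 * n + l) * (81 * ?f)"
  proof (intro mult_left_mono)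
    have "real (Suc n) * fact (n + l) \<le> real (Suc (n + l)) * fact (n + l)"
      by (intro mult_right_mono) auto
    also have "\<dots> = fact (Suc (n + l))" by simp
    also have "\<dots> \<le> ?f" by (intro fact_mono) simp
    finally have "real (Suc n) * fact (n + l) \<le> ?f" .
    moreover have "?f \<ge> 0" by simp
    ultimately show "54 * ?f + 2 * (real (Suc n) * fact (n + l)) \<le> 81 * ?f" by linarith
  qed auto
  also have "\<dots> = exp 1 * 3 ^ (2 * Suc (Suc n) + l) * ?f"
    by (simp add: power_add)
  finally show ?case .
qed

text \<open>The growth is \<open>9 ^ n * fact n\<close> with n = j + l, and the spare
  \<open>fact n powr (d - 1)\<close> absorbs the geometric factor for every h. This is where d > 1,
  rather than d \<ge> 1, enters.\<close>

lemma gauss_in_gelfand_shilov: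
  assumes "d > 1"
  shows "gauss_deriv 0 \<in> gelfand_shilov d"
  unfolding gelfand_shilov_iff
proof (intro conjI allI impI)
  show "smooth (gauss_deriv 0)"
    by (rule smoothI[of gauss_deriv, OF gauss_deriv refl])
  fix h :: real assume "h > 0"
  then obtain A where A: "A \<ge> 0" "\<And>n. 9 ^ n \<le> A * (h ^ n * fact n powr (d - 1))"
    using power_le_fact_powr[of 9 h "d - 1"] assms by auto
  have "gs_bound d h (exp 1 * A) (gauss_deriv 0)"
    unfolding gs_bound_def
  proof (intro allI)
    fix x :: real and j l :: nat
    let ?n = "j + l"
    have "iter_deriv j (gauss_deriv 0) = gauss_deriv j"
      by (rule ext iter_deriv_eqI[of gauss_deriv, OF gauss_deriv refl])+
    then have "norm (x ^ l *\<^sub>R iter_deriv j (gauss_deriv 0) x) \<le> exp 1 * 3 ^ (2 * j + l) * fact ?n"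
      using norm_gauss_deriv_le by simp
    also have "\<dots> \<le> exp 1 * 3 ^ (2 * ?n) * fact ?n"
      by (intro mult_right_mono mult_left_mono power_increasing) auto
    also have "\<dots> = exp 1 * 9 ^ ?n * fact ?n"
      unfolding power_mult by simp
    also have "\<dots> \<le> exp 1 * (A * (h ^ ?n * fact ?n powr (d - 1))) * fact ?n"
      by (intro mult_right_mono mult_left_mono A) auto
    also have "\<dots> = exp 1 * A * (h ^ ?n * fact ?n powr d)"
      by (simp add: powr_diff)
    finally show "norm (x ^ l *\<^sub>R iter_deriv j (gauss_deriv 0) x) \<le> exp 1 * A * (h ^ ?n * fact ?n powr d)" .
  qed
  then show "\<exists>B. gs_bound d h B (gauss_deriv 0)" ..
qed

section \<open>Oscillating test functions\<close>

text \<open>All decay comes from g; s only needs bounded derivatives. In Leibniz' formula k! (j - k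
  + l)! \<le> (j + l)! merges the factorials, and the binomial coefficients sum to 2^j, which is
  paid for by doubling h.\<close>

lemma gs_bound_mult:
  fixes s :: "real \<Rightarrow> real"
  assumes smooth: "smooth s" "smooth g" and nonneg: "h > 0" "d \<ge> 0" "A \<ge> 0"
    and s: "\<And>i x. \<bar>iter_deriv i s x\<bar> \<le> A * (h ^ i * fact i powr d)" and g: "gs_bound d h B g"
  shows "gs_bound d (2 * h) (A * B) (\<lambda>x. s x *\<^sub>R g x)"
  unfolding gs_bound_def
proof (intro allI)
  fix x :: real and j l :: nat
  let ?R = "A * B * (h ^ (j + l) * fact (j + l) powr d)"
  have B: "B \<ge> 0" by (rule gs_bound_nonneg[OF g])
  have bound: "norm ((real (j choose k) * iter_deriv k s x) *\<^sub>R (x ^ l *\<^sub>R iter_deriv (j - k) g x))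
      \<le> real (j choose k) * ?R" if "k \<le> j" for k
  proof -
    have "(fact k * fact (j - k + l) :: nat) \<le> fact (j + l)"
      using fact_fact_dvd_fact[of k "j - k + l"] that by (intro dvd_imp_le) (simp_all add: add.commute)
    then have fact_le: "(fact k * fact (j - k + l) :: real) \<le> fact (j + l)"
      by (metis of_nat_fact of_nat_le_iff of_nat_mult)
    have "\<bar>iter_deriv k s x\<bar> * norm (x ^ l *\<^sub>R iter_deriv (j - k) g x)
        \<le> (A * (h ^ k * fact k powr d)) * (B * (h ^ (j - k + l) * fact (j - k + l) powr d))"
      using g nonneg by (intro mult_mono s) (auto simp: gs_bound_def)
    also have "\<dots> = A * B * (h ^ (k + (j - k + l)) * (fact k * fact (j - k + l)) powr d)"
      by (simp add: power_add powr_mult)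
    also have "\<dots> \<le> ?R"
      using that nonneg B fact_le by (auto intro!: mult_left_mono powr_mono2)
    finally have "real (j choose k) * (\<bar>iter_deriv k s x\<bar> * norm (x ^ l *\<^sub>R iter_deriv (j - k) g x))
        \<le> real (j choose k) * ?R"
      by (intro mult_left_mono) auto
    then show ?thesis
      by (simp add: abs_mult mult.assoc)
  qed
  have "norm (x ^ l *\<^sub>R iter_deriv j (\<lambda>x. s x *\<^sub>R g x) x)
     = norm (\<Sum>k\<le>j. (real (j choose k) * iter_deriv k s x) *\<^sub>R (x ^ l *\<^sub>R iter_deriv (j - k) g x))"
    by (simp add: iter_deriv_mult[OF smooth] scaleR_sum_right mult_ac)
  also have "\<dots> \<le> (\<Sum>k\<le>j. real (j choose k) * ?R)"
    by (rule order_trans[OF norm_sum sum_mono]) (use bound in auto)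
  also have "\<dots> = 2 ^ j * ?R"
    by (simp add: choose_row_sum flip: sum_distrib_right of_nat_sum)
  also have "\<dots> \<le> 2 ^ (j + l) * ?R"
    using nonneg B by (intro mult_right_mono power_increasing) auto
  also have "\<dots> = A * B * ((2 * h) ^ (j + l) * fact (j + l) powr d)"
    by (simp add: power_mult_distrib)
  finally show "norm (x ^ l *\<^sub>R iter_deriv j (\<lambda>x. s x *\<^sub>R g x) x)
      \<le> A * B * ((2 * h) ^ (j + l) * fact (j + l) powr d)" .
qed

lemma
  fixes \<xi> y :: real
  shows smooth_sin: "smooth (\<lambda>x. sin (\<xi> * (x - y)))"
    and iter_deriv_sin: "iter_deriv n (\<lambda>x. sin (\<xi> * (x - y))) = (\<lambda>x. \<xi> ^ n * sin (\<xi> * (x - y) + real n * (pi / 2)))"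
proof -
  let ?D = "\<lambda>n x. \<xi> ^ n * sin (\<xi> * (x - y) + real n * (pi / 2))"
  have *: "(?D n has_vector_derivative ?D (Suc n) x) (at x)" for n x
  proof -
    have "sin (\<xi> * (x - y) + real (Suc n) * (pi / 2)) = sin ((\<xi> * (x - y) + real n * (pi / 2)) + pi / 2)"
      by (simp add: field_simps)
    then have "sin (\<xi> * (x - y) + real (Suc n) * (pi / 2)) = cos (\<xi> * (x - y) + real n * (pi / 2))"
      unfolding sin_add[of _ "pi / 2"] by simp
    then show ?thesis
      unfolding has_real_derivative_iff_has_vector_derivative[symmetric]
      by (auto intro!: derivative_eq_intros)
  qed
  show "smooth (\<lambda>x. sin (\<xi> * (x - y)))"
    by (rule smoothI[where D = ?D]) (use * in auto)
  show "iter_deriv n (\<lambda>x. sin (\<xi> * (x - y))) = ?D n"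
    by (rule iter_deriv_eqI[where D = ?D]) (use * in auto)
qed

text \<open>A j-th power of a sine is a trigonometric polynomial with frequencies up to j \<xi>,
  whence the derivative bound, and it has a zero of order j at y. Both follow by peeling off one
  sine with Leibniz' formula.\<close>

lemma sin_power:
  fixes \<xi> y :: real
  assumes "\<xi> \<ge> 0"
  defines "s \<equiv> \<lambda>j x. sin (\<xi> * (x - y)) ^ j"
  shows "smooth (s j)"
    and "\<bar>iter_deriv i (s j) x\<bar> \<le> (real j * \<xi>) ^ i"
    and "i < j \<Longrightarrow> iter_deriv i (s j) y = 0"
    and "iter_deriv j (s j) y = fact j * \<xi> ^ j"
proof -
  let ?sin = "\<lambda>x. sin (\<xi> * (x - y))"
  have "smooth (s j) \<and> (\<forall>i x. \<bar>iter_deriv i (s j) x\<bar> \<le> (real j * \<xi>) ^ i) \<and>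
    (\<forall>i<j. iter_deriv i (s j) y = 0) \<and> iter_deriv j (s j) y = fact j * \<xi> ^ j"
  proof (induction j)
    case 0
    then show ?case
      by (simp add: s_def iter_deriv_const smooth_const)
  next
    case (Suc j)
    have s_Suc: "s (Suc j) = (\<lambda>x. s j x *\<^sub>R ?sin x)"
      by (simp add: s_def mult.commute)
    have smooth_j: "smooth (s j)" using Suc by simp
    have leibniz: "iter_deriv i (s (Suc j)) x = (\<Sum>k\<le>i. real (i choose k) * iter_deriv k (s j) x *
        (\<xi> ^ (i - k) * sin (\<xi> * (x - y) + real (i - k) * (pi / 2))))" for i x
      unfolding s_Suc iter_deriv_mult[OF smooth_j smooth_sin] iter_deriv_sin
      unfolding real_scaleR_def by (rule refl)
    have "\<bar>iter_deriv i (s (Suc j)) x\<bar> \<le> (real (Suc j) * \<xi>) ^ i" for i x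
    proof -
      have "\<bar>iter_deriv i (s (Suc j)) x\<bar> \<le> (\<Sum>k\<le>i. \<bar>real (i choose k) * iter_deriv k (s j) x *
        (\<xi> ^ (i - k) * sin (\<xi> * (x - y) + real (i - k) * (pi / 2)))\<bar>)"
        unfolding leibniz by (rule sum_abs)
      also have "\<dots> \<le> (\<Sum>k\<le>i. real (i choose k) * (real j * \<xi>) ^ k * (\<xi> ^ (i - k) * 1))"
        unfolding abs_mult using Suc assms
        by (intro sum_mono mult_mono) auto
      \<comment> \<open>The Leibniz sum of the bounds is exactly a binomial expansion, so no
        constant is lost.\<close>
      also have "\<dots> = (real j * \<xi> + \<xi>) ^ i"
        by (simp add: binomial_ring)
      finally show ?thesis by (simp add: algebra_simps)
    qed
    moreover have "iter_deriv i (s (Suc j)) y = 0" if i: "i < Suc j" for i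
      unfolding leibniz
    proof (intro sum.neutral ballI)
      fix k assume "k \<in> {..i}"
      then consider "k < j" | "k = i" using i by force
      then show "real (i choose k) * iter_deriv k (s j) y *
        (\<xi> ^ (i - k) * sin (\<xi> * (y - y) + real (i - k) * (pi / 2))) = 0"
        using Suc by cases auto
    qed
    moreover have "iter_deriv (Suc j) (s (Suc j)) y = fact (Suc j) * \<xi> ^ Suc j"
    proof -
      have "iter_deriv (Suc j) (s (Suc j)) y = (\<Sum>k\<in>{j}. real (Suc j choose k) * iter_deriv k (s j) y *
        (\<xi> ^ (Suc j - k) * sin (\<xi> * (y - y) + real (Suc j - k) * (pi / 2))))"
        unfolding leibniz
      proof (intro sum.mono_neutral_right ballI)
        fix k assume "k \<in> {..Suc j} - {j}"
        then consider "k < j" | "k = Suc j" by force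
        then show "real (Suc j choose k) * iter_deriv k (s j) y *
          (\<xi> ^ (Suc j - k) * sin (\<xi> * (y - y) + real (Suc j - k) * (pi / 2))) = 0"
          using Suc by cases auto
      qed auto
      also have "\<dots> = fact (Suc j) * \<xi> ^ Suc j"
        using Suc by simp
      finally show ?thesis .
    qed
    moreover have "smooth (s (Suc j))"
      unfolding s_Suc by (rule smooth_mult[OF smooth_j smooth_sin])
    ultimately show ?case by blast
  qed
  then show "smooth (s j)" "\<bar>iter_deriv i (s j) x\<bar> \<le> (real j * \<xi>) ^ i"
    "i < j \<Longrightarrow> iter_deriv i (s j) y = 0" "iter_deriv j (s j) y = fact j * \<xi> ^ j"
    by auto
qed

text \<open>The two upper bounds serve different ends. The one at h, with constant 1 for all j and
  y, keeps the test functions in one seminorm ball; the one for every h', with a constant that may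
  depend on j, puts them into the space.\<close>

lemma oscillating_factor:
  fixes d h y :: real
  assumes d: "d \<ge> 1" and h: "h > 0" and j: "j > 0"
  obtains s where "smooth s" "\<And>i x. \<bar>iter_deriv i s x\<bar> \<le> h ^ i * fact i powr d"
    "\<And>h'. h' > 0 \<Longrightarrow> \<exists>A\<ge>0. \<forall>i x. \<bar>iter_deriv i s x\<bar> \<le> A * (h' ^ i * fact i powr d)"
    "\<And>i. i < j \<Longrightarrow> iter_deriv i s y = 0" "iter_deriv j s y \<ge> (h * exp (- d)) ^ j * fact j powr d"
proof -
  define \<xi> where "\<xi> = h * real j powr (d - 1)"
  define a where "a = exp (- real j) powr d"
  have \<xi>: "\<xi> \<ge> 0" using h by (simp add: \<xi>_def)
  have a: "a > 0" "a \<le> 1" "a = exp (- d) ^ j"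
    using d by (simp_all add: a_def powr_def exp_of_nat_mult[symmetric] mult.commute)
  let ?p = "\<lambda>x. sin (\<xi> * (x - y)) ^ j"
  note p = sin_power[OF \<xi>, where y = y and j = j]
  define s where "s x = a *\<^sub>R ?p x" for x
  have s: "smooth s" "iter_deriv i s x = a * iter_deriv i ?p x" for i x
    using smooth_scaleR[OF p(1), of a] iter_deriv_scaleR[OF p(1), of i a] by (simp_all add: s_def[abs_def])
  have s_le: "\<bar>iter_deriv i s x\<bar> \<le> a * (real j * \<xi>) ^ i" for i x
    using p(2)[of i x] a by (simp add: s abs_mult)
  show thesis
  proof (rule that[OF s(1)])
    show "\<bar>iter_deriv i s x\<bar> \<le> h ^ i * fact i powr d" for i x
    proof -
      have "real j * \<xi> = h * real j powr d"
        using j by (simp add: \<xi>_def powr_diff)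
      then have "a * (real j * \<xi>) ^ i = h ^ i * (exp (- real j) * real j ^ i) powr d"
        by (simp add: a_def powr_mult power_mult_distrib power_powr_commute)
      also have "\<dots> \<le> h ^ i * fact i powr d"
        using power_le_exp_fact[of "real j" i] h d
        by (intro mult_left_mono powr_mono2) (auto simp: exp_minus field_simps)
      finally show ?thesis using s_le[of i x] by simp
    qed
    show "\<exists>A\<ge>0. \<forall>i x. \<bar>iter_deriv i s x\<bar> \<le> A * (h' ^ i * fact i powr d)" if h': "h' > 0" for h'
    proof -
      obtain A where A: "A \<ge> 0" "\<And>n. (real j * \<xi>) ^ n \<le> A * (h' ^ n * fact n powr d)"
        using power_le_fact_powr[of "real j * \<xi>" h' d] h' \<xi> d by auto
      have "a * (real j * \<xi>) ^ i \<le> 1 * (real j * \<xi>) ^ i" for i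
        using a \<xi> by (intro mult_right_mono) auto
      then have "\<bar>iter_deriv i s x\<bar> \<le> A * (h' ^ i * fact i powr d)" for i x
        using A(2)[of i] s_le[of i x] by (smt (verit))
      then show ?thesis using A(1) by blast
    qed
    show "iter_deriv i s y = 0" if "i < j" for i
      using p(3)[OF that] by (simp add: s)
    show "iter_deriv j s y \<ge> (h * exp (- d)) ^ j * fact j powr d"
    proof -
      \<comment> \<open>By j! \<le> j^j the power of the frequency supplies the missing
        \<open>fact j powr (d - 1)\<close>; the other factor j! comes from differentiating the zero
        of order j.\<close>
      have "(fact j :: real) \<le> real j ^ j"
        using fact_le_power[of j, where 'a = real] by simp
      then have "fact j powr (d - 1) \<le> (real j ^ j) powr (d - 1)"
        using d by (intro powr_mono2) auto
      also have "\<dots> = (real j powr (d - 1)) ^ j"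
        by (rule power_powr_commute)
      finally have "fact j powr (d - 1) \<le> (real j powr (d - 1)) ^ j" .
      then have "a * h ^ j * fact j * fact j powr (d - 1) \<le> a * h ^ j * fact j * (real j powr (d - 1)) ^ j"
        using a h by (intro mult_left_mono) auto
      moreover have "a * h ^ j * fact j * (real j powr (d - 1)) ^ j = iter_deriv j s y"
        unfolding s p(4) by (simp add: \<xi>_def power_mult_distrib)
      moreover have "a * h ^ j * fact j * fact j powr (d - 1) = (h * exp (- d)) ^ j * fact j powr d"
        by (simp add: a(3) powr_diff power_mult_distrib)
      ultimately show ?thesis by simp
    qed
  qed
qed

section \<open>From the uniform estimate to the bound on \<psi>'\<close>

theorem theorem3p9:
  fixes d :: real and \<psi> :: "real \<Rightarrow> real"
  assumes "d > 1"
    and "smooth \<psi>"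
    and "\<And>f. f \<in> gelfand_shilov d \<Longrightarrow> f \<circ> \<psi> \<in> gelfand_shilov d"
  shows "bounded (range (deriv \<psi>))"
proof -
  let ?S = "gelfand_shilov d"
  \<comment> \<open>Indexing by pairs makes the estimate uniform in the point and the order at once.
    The normalisation is that of the seminorm with h = 1 and l = 0, so pointwise boundedness is the
    hypothesis on \<open>f \<circ> \<psi>\<close>.\<close>
  define T where "T = (\<lambda>(x, j) (f :: real \<Rightarrow> complex). (1 / fact j powr d) *\<^sub>R iter_deriv j (f \<circ> \<psi>) x)"
  have smooth_comp: "smooth (f \<circ> \<psi>)" if "f \<in> ?S" for f
    by (rule gelfand_shilov_smooth[OF assms(3)[OF that]])
  have "\<exists>h>0. \<exists>C. \<forall>i f B. f \<in> ?S \<longrightarrow> gs_bound d h B f \<longrightarrow> norm (T i f) \<le> C * B"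
  proof (rule gelfand_shilov_uniform_boundedness)
    show "T i (\<lambda>x. f x + g x) = T i f + T i g" if "f \<in> ?S" "g \<in> ?S" for i f g
      using iter_deriv_add[OF smooth_comp[OF that(1)] smooth_comp[OF that(2)]]
      by (cases i) (simp add: T_def o_def scaleR_add_right)
    show "T i (\<lambda>x. c *\<^sub>R f x) = c *\<^sub>R T i f" if "f \<in> ?S" for i f c
      using iter_deriv_scaleR[OF smooth_comp[OF that]]
      by (cases i) (simp add: T_def o_def)
    show "\<exists>E. \<forall>f B. f \<in> ?S \<longrightarrow> gs_bound d 1 B f \<longrightarrow> norm (T i f) \<le> E * B" for i
    proof -
      obtain x j where i: "i = (x, j)" by fastforce
      obtain c :: "nat \<Rightarrow> real \<Rightarrow> real" where c: "\<And>(f :: real \<Rightarrow> complex) x. smooth f \<Longrightarrow>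
          iter_deriv j (f \<circ> \<psi>) x = (\<Sum>k\<le>j. c k x *\<^sub>R iter_deriv k f (\<psi> x))"
        using faa_di_bruno[OF assms(2), of j] by blast
      \<comment> \<open>This constant depends on x and j through the chain rule coefficients, which
        is allowed: continuity is asked of each functional separately.\<close>
      define K where "K = (\<Sum>k\<le>j. \<bar>c k x\<bar> * fact k powr d)"
      have "norm (T i f) \<le> 1 / fact j powr d * K * B" if f: "f \<in> ?S" "gs_bound d 1 B f" for f B
      proof -
        have "norm (iter_deriv k f (\<psi> x)) \<le> B * fact k powr d" for k
          using gs_bound_iter_deriv[OF f(2), of k "\<psi> x"] by simp
        then have "norm (\<Sum>k\<le>j. c k x *\<^sub>R iter_deriv k f (\<psi> x)) \<le> (\<Sum>k\<le>j. \<bar>c k x\<bar> * (B * fact k powr d))"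
          by (intro order_trans[OF norm_sum sum_mono]) (auto intro: mult_left_mono)
        also have "\<dots> = K * B"
          by (simp add: K_def sum_distrib_left mult_ac)
        finally have "norm (iter_deriv j (f \<circ> \<psi>) x) \<le> K * B"
          by (simp only: c[OF gelfand_shilov_smooth[OF f(1)]])
        then show ?thesis
          by (simp add: i T_def divide_right_mono)
      qed
      then show ?thesis by blast
    qed
    show "\<exists>M. \<forall>i. norm (T i f) \<le> M" if f: "f \<in> ?S" for f
    proof -
      obtain B where B: "gs_bound d 1 B (f \<circ> \<psi>)"
        by (rule gelfand_shilovE[OF assms(3)[OF f], of 1]) simp
      have "norm (iter_deriv j (f \<circ> \<psi>) x) \<le> B * fact j powr d" for j x
        using gs_bound_iter_deriv[OF B, of j x] by simp
      then have "norm (T i f) \<le> B" for i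
        by (cases i) (simp add: T_def field_simps)
      then show ?thesis by blast
    qed
  qed
  then obtain h C where h: "h > 0"
    and T: "\<And>i f B. f \<in> ?S \<Longrightarrow> gs_bound d h B f \<Longrightarrow> norm (T i f) \<le> C * B"
    by blast
  \<comment> \<open>Multiplication doubles the parameter, so both factors are taken at
    \<open>h / 2\<close>. B is fixed here, before x and j.\<close>
  obtain B where B: "gs_bound d (h / 2) B (gauss_deriv 0)"
    by (rule gelfand_shilovE[OF gauss_in_gelfand_shilov[OF assms(1)], of "h / 2"]) (use h in simp)
  have smooth_gauss: "smooth (gauss_deriv 0)"
    by (rule gelfand_shilov_smooth[OF gauss_in_gelfand_shilov[OF assms(1)]])
  have growth: "(h / 2 * exp (- d) * \<bar>iter_deriv 1 \<psi> x\<bar>) ^ j * exp (- (\<psi> x)\<^sup>2) \<le> C * B" if j: "j > 0" for x j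
  proof -
    obtain s where s: "smooth s" "\<And>i x. \<bar>iter_deriv i s x\<bar> \<le> (h / 2) ^ i * fact i powr d"
      "\<And>h'. h' > 0 \<Longrightarrow> \<exists>A\<ge>0. \<forall>i x. \<bar>iter_deriv i s x\<bar> \<le> A * (h' ^ i * fact i powr d)"
      "\<And>i. i < j \<Longrightarrow> iter_deriv i s (\<psi> x) = 0" "iter_deriv j s (\<psi> x) \<ge> (h / 2 * exp (- d)) ^ j * fact j powr d"
      using oscillating_factor[of d "h / 2" j "\<psi> x"] assms(1) h j by auto
    define f where "f y = s y *\<^sub>R gauss_deriv 0 y" for y
    have smooth_f: "smooth f"
      unfolding f_def[abs_def] by (rule smooth_mult[OF s(1) smooth_gauss])
    have f: "f \<in> ?S"
      unfolding gelfand_shilov_iff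
    proof (intro conjI allI impI smooth_f)
      fix h' :: real assume h': "h' > 0"
      obtain A where A: "A \<ge> 0" "\<And>i x. \<bar>iter_deriv i s x\<bar> \<le> A * ((h' / 2) ^ i * fact i powr d)"
        using s(3)[of "h' / 2"] h' by auto
      obtain B' where "gs_bound d (h' / 2) B' (gauss_deriv 0)"
        by (rule gelfand_shilovE[OF gauss_in_gelfand_shilov[OF assms(1)], of "h' / 2"]) (use h' in simp)
      from gs_bound_mult[OF s(1) smooth_gauss _ _ A this] assms(1) h'
      show "\<exists>B. gs_bound d h' B f" by (auto simp: f_def[abs_def])
    qed
    have "gs_bound d h B f"
      using gs_bound_mult[OF s(1) smooth_gauss _ _ _ _ B, of 1] s(2) assms(1) h
      by (auto simp: f_def[abs_def])
    then have le: "norm (T (x, j) f) \<le> C * B"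
      by (rule T[OF f])
    \<comment> \<open>Derivatives of s of order below j vanish at \<open>\<psi> x\<close>, so
      Leibniz' formula keeps only the term with all i derivatives on s, and for i < j this term is 0
      as well.\<close>
    have deriv_f: "iter_deriv i f (\<psi> x) = iter_deriv i s (\<psi> x) *\<^sub>R gauss_deriv 0 (\<psi> x)" if "i \<le> j" for i
    proof -
      have "iter_deriv i f (\<psi> x) = (\<Sum>k\<in>{i}. (real (i choose k) * iter_deriv k s (\<psi> x)) *\<^sub>R
          iter_deriv (i - k) (gauss_deriv 0) (\<psi> x))"
        unfolding f_def[abs_def] iter_deriv_mult[OF s(1) smooth_gauss]
        by (rule sum.mono_neutral_right) (use that s(4) in auto)
      then show ?thesis by simp
    qed
    obtain c :: "nat \<Rightarrow> real \<Rightarrow> real" where c: "\<And>x. c j x = iter_deriv 1 \<psi> x ^ j"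
      "\<And>(f :: real \<Rightarrow> complex) x. smooth f \<Longrightarrow> iter_deriv j (f \<circ> \<psi>) x = (\<Sum>k\<le>j. c k x *\<^sub>R iter_deriv k f (\<psi> x))"
      using faa_di_bruno[OF assms(2), of j] by blast
    have "iter_deriv j (f \<circ> \<psi>) x = (\<Sum>k\<in>{j}. c k x *\<^sub>R iter_deriv k f (\<psi> x))"
      unfolding c(2)[OF smooth_f] by (rule sum.mono_neutral_right) (use deriv_f s(4) in auto)
    then have eq: "norm (iter_deriv j (f \<circ> \<psi>) x)
        = \<bar>iter_deriv 1 \<psi> x\<bar> ^ j * \<bar>iter_deriv j s (\<psi> x)\<bar> * exp (- (\<psi> x)\<^sup>2)"
      by (simp add: c(1) deriv_f power_abs abs_mult)
    have "(h / 2 * exp (- d) * \<bar>iter_deriv 1 \<psi> x\<bar>) ^ j * exp (- (\<psi> x)\<^sup>2) * fact j powr d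
        = \<bar>iter_deriv 1 \<psi> x\<bar> ^ j * ((h / 2 * exp (- d)) ^ j * fact j powr d) * exp (- (\<psi> x)\<^sup>2)"
      by (simp only: power_mult_distrib mult_ac)
    also have "\<dots> \<le> norm (iter_deriv j (f \<circ> \<psi>) x)"
      unfolding eq using s(5) by (intro mult_right_mono mult_left_mono) auto
    also have "\<dots> \<le> C * B * fact j powr d"
      using le by (simp add: T_def field_simps)
    finally show ?thesis by simp
  qed
  have "\<bar>iter_deriv 1 \<psi> x\<bar> \<le> 2 * exp d / h" for x
  proof (rule ccontr)
    let ?q = "h / 2 * exp (- d) * \<bar>iter_deriv 1 \<psi> x\<bar>"
    assume "\<not> ?thesis"
    then have "?q > 1"
      using h by (simp add: exp_minus field_simps)
    then obtain n where n: "?q ^ n > C * B / exp (- (\<psi> x)\<^sup>2)"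
      using real_arch_pow by blast
    \<comment> \<open>One more power, because \<open>growth\<close> holds for positive
      orders.\<close>
    also have "?q ^ n \<le> ?q ^ Suc n"
      using \<open>?q > 1\<close> by (intro power_increasing) auto
    finally have "C * B < ?q ^ Suc n * exp (- (\<psi> x)\<^sup>2)"
      by (simp only: pos_divide_less_eq exp_gt_zero)
    then show False
      using growth[of "Suc n" x] by simp
  qed
  moreover have "deriv \<psi> x = iter_deriv 1 \<psi> x" for x
    using smooth_has_vector_derivative[OF assms(2), of 0 x]
    by (intro DERIV_imp_deriv) (simp add: has_real_derivative_iff_has_vector_derivative)
  ultimately show ?thesis
    by (auto simp: bounded_iff)
qed

end
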